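(* Let $L>0$, let $f:\mathbb{R}^d\to\mathbb{R}$ be convex and $L$-smooth, and let $x^\star$ be a minimizer of $f$, with $f^\star=f(x^\star)$. Set $A_k=(1+k/12)^{4/3}$ for $k\ge0$. Independently sample $u_k\sim\operatorname{Unif}(A_k,A_{k+1})$ for every $k\ge0$. Put $$\delta_k=\frac12\Big(\frac1{u_k^2}-\frac1{u_{k+1}^2}\Big),\qquad \eta_k=\frac{(A_{k+1}-A_k)\,u_k^2\,\delta_k}{L}\quad(k\ge0),\qquad \beta_k=\frac{\delta_k}{\delta_{k-1}}\quad(k\ge1),\qquad\beta_0=0$$ (all $\delta_k$ are positive almost surely). Then, for any starting point $x^0\in\mathbb{R}^d$, the heavy-ball iterates $$x^{k+1}=x^k-\eta_k\nabla f(x^k)+\beta_k(x^k-x^{k-1}),\quad k\ge0,\qquad x^{-1}=x^0,$$ satisfy $$\mathbb{P}\Big(\sup_{K\ge1}K^{4/3}[f(x^K)-f^\star]<\infty\Big)=1.$$ In particular, $f(x^K)-f^\star=O(K^{-4/3})$ almost surely along the same infinite trajectory.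
   Context: $\|\cdot\|$ is the Euclidean norm on $\mathbb{R}^d$. A function $f$ is $L$-smooth if it is differentiable and $\|\nabla f(x)-\nabla f(y)\|\le L\|x-y\|$ for all $x,y\in\mathbb{R}^d$. The starting point $x^0$ is deterministic and the gradient oracle is exact; the only randomness is in the sampled times $(u_k)_{k\ge0}$. *)

theory Defs
  imports "HOL-Probability.Probability" "HOL-Library.Landau_Symbols"
begin

definition gradient :: "('a::real_inner \<Rightarrow> real) \<Rightarrow> 'a \<Rightarrow> 'a" where
  "gradient f x = (THE D. GDERIV f x :> D)"

lemma gradient_eqI:
  assumes "GDERIV f x :> D"
  shows "gradient f x = D"
  unfolding gradient_def
proof (rule the_equality[where P = "\<lambda>D. GDERIV f x :> D", OF assms])
  fix D' assume "GDERIV f x :> D'"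
  then have "(\<lambda>h. inner h D') = (\<lambda>h. inner h D)"
    using assms unfolding gderiv_def by (rule has_derivative_unique)
  then have "inner (D' - D) D' = inner (D' - D) D"
    by (rule fun_cong)
  then have "inner (D' - D) (D' - D) = 0"
    by (simp add: inner_diff_right)
  then show "D' = D"
    by simp
qed

lemma GDERIV_gradient:
  fixes f :: "'a::euclidean_space \<Rightarrow> real"
  assumes "f differentiable (at x)"
  shows "GDERIV f x :> gradient f x"
proof -
  from assms obtain f' where f': "(f has_derivative f') (at x)"
    by (auto simp: differentiable_def)
  then have "f' = (\<lambda>h. inner h (adjoint f' 1))"
    using adjoint_works[OF has_derivative_linear, OF f', of _ 1] by (auto simp: fun_eq_iff)
  with f' have "GDERIV f x :> adjoint f' 1"
    by (simp add: gderiv_def)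
  then show ?thesis
    by (simp only: gradient_eqI)
qed

definition L_smooth :: "real \<Rightarrow> ('a::real_inner \<Rightarrow> real) \<Rightarrow> bool" where
  "L_smooth L f \<longleftrightarrow> (\<forall>x. f differentiable (at x)) \<and>
     (\<forall>x y. norm (gradient f x - gradient f y) \<le> L * norm (x - y))"

definition A_seq :: "nat \<Rightarrow> real" where
  "A_seq k = (1 + real k / 12) powr (4 / 3)"

text \<open>In the parameters below, \<open>u\<close> is one realization of the whole sequence of sampled times.\<close>

definition delta :: "(nat \<Rightarrow> real) \<Rightarrow> nat \<Rightarrow> real" where
  "delta u k = 1 / 2 * (1 / (u k)\<^sup>2 - 1 / (u (k + 1))\<^sup>2)"

definition eta :: "real \<Rightarrow> (nat \<Rightarrow> real) \<Rightarrow> nat \<Rightarrow> real" where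
  "eta L u k = (A_seq (k + 1) - A_seq k) * (u k)\<^sup>2 * delta u k / L"

definition beta :: "(nat \<Rightarrow> real) \<Rightarrow> nat \<Rightarrow> real" where
  "beta u k = (if k = 0 then 0 else delta u k / delta u (k - 1))"

text \<open>For \<open>k = 0\<close> the truncated subtraction \<open>k - 1 = 0\<close> yields the convention
  that the iterate with index \<open>-1\<close> equals the starting point.\<close>

fun heavy_ball ::
  "('a::real_vector \<Rightarrow> 'a) \<Rightarrow> (nat \<Rightarrow> real) \<Rightarrow> (nat \<Rightarrow> real) \<Rightarrow> 'a \<Rightarrow> nat \<Rightarrow> 'a" where
  "heavy_ball g \<eta> \<beta> x0 0 = x0"
| "heavy_ball g \<eta> \<beta> x0 (Suc k) =
     heavy_ball g \<eta> \<beta> x0 k - \<eta> k *\<^sub>R g (heavy_ball g \<eta> \<beta> x0 k)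
     + \<beta> k *\<^sub>R (heavy_ball g \<eta> \<beta> x0 k - heavy_ball g \<eta> \<beta> x0 (k - 1))"

end

theory Submission
  imports Defs
begin

text \<open>Heavy ball is a randomized discretization of
  \<open>x' = 2 (z - x) / t\<close>, \<open>z' = - \<nabla>f x / (2 L)\<close>: the variable \<open>z\<close> jumps at the uniformly
  sampled time \<open>u\<^sub>k\<close> by the amount the flow would accumulate over \<open>(A\<^sub>k, A\<^sub>k\<^sub>+\<^sub>1)\<close>, and \<open>x\<close> moves
  ballistically in between. Observed at the deterministic times \<open>A\<^sub>k\<close>, the energy
  \<open>A\<^sub>k (f x - f\<^sup>\<star>) + L |z - x\<^sup>\<star>|\<^sup>2 + L |z - x|\<^sup>2\<close> is a nonnegative supermartingale:
  uniform sampling makes the jump unbiased, and the remaining discretization error is absorbed by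
  \<open>|\<nabla>f|\<^sup>2\<close> and \<open>|z - x|\<^sup>2 / t\<close> because \<open>(A\<^sub>k\<^sub>+\<^sub>1 - A\<^sub>k)\<^sup>4 \<le> A\<^sub>k\<^sub>+\<^sub>1 / 9\<^sup>4\<close>, which is
  where the growth \<open>A\<^sub>k \<sim> k\<^sup>4\<^sup>/\<^sup>3\<close> comes from. A maximal inequality bounds the energy along
  almost every trajectory.\<close>

subsection \<open>Smooth convex functions\<close>

locale smooth_convex =
  fixes f :: "'a::euclidean_space \<Rightarrow> real" and L :: real and xs :: 'a
  assumes L_pos: "L > 0"
    and convex: "convex_on UNIV f"
    and smooth: "L_smooth L f"
    and minimizer: "f xs \<le> f y"
begin

abbreviation g :: "'a \<Rightarrow> 'a" where "g \<equiv> gradient f"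

lemma has_derivative_gradient: "(f has_derivative (\<lambda>h. inner h (g x))) (at x)"
  using GDERIV_gradient[of f x] smooth by (simp add: L_smooth_def gderiv_def)

lemma gradient_lipschitz: "norm (g x - g y) \<le> L * norm (x - y)"
  using smooth by (simp add: L_smooth_def)

lemma continuous_gradient: "continuous_on S g"
proof (rule continuous_on_subset[OF lipschitz_on_continuous_on])
  show "L-lipschitz_on UNIV g"
    using gradient_lipschitz L_pos by (intro lipschitz_onI) (auto simp: dist_norm)
qed simp

lemma continuous_f: "continuous_on S f"
  by (intro continuous_at_imp_continuous_on ballI has_derivative_continuous[OF has_derivative_gradient])

lemma has_real_derivative_along_path:
  assumes "(y has_vector_derivative y') (at t within S)"
  shows "((\<lambda>t. f (y t)) has_real_derivative inner y' (g (y t))) (at t within S)"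
proof -
  have "((\<lambda>t. f (y t)) has_derivative (\<lambda>h. inner (h *\<^sub>R y') (g (y t)))) (at t within S)"
    using has_derivative_compose[OF _ has_derivative_gradient] assms
    unfolding has_vector_derivative_def by blast
  then show ?thesis
    by (simp add: has_field_derivative_def mult_commute_abs)
qed

text \<open>Restricting \<open>f\<close> to the line through \<open>x\<close> and \<open>y\<close>
  reduces this to the tangent inequality for a convex function of one variable.\<close>

lemma gradient_inequality: "f y \<ge> f x + inner (y - x) (g x)"
proof -
  define c where "c t = f (x + t *\<^sub>R (y - x))" for t
  have "convex_on UNIV c"
  proof (rule convex_onI)
    fix t a b :: real assume t: "0 < t" "t < 1"
    have "x + ((1 - t) *\<^sub>R a + t *\<^sub>R b) *\<^sub>R (y - x)
        = (1 - t) *\<^sub>R (x + a *\<^sub>R (y - x)) + t *\<^sub>R (x + b *\<^sub>R (y - x))"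
      by (simp add: algebra_simps)
    then show "c ((1 - t) *\<^sub>R a + t *\<^sub>R b) \<le> (1 - t) * c a + t * c b"
      unfolding c_def using t convex_onD[OF convex, of t] by simp
  qed simp
  moreover have "(c has_real_derivative inner (y - x) (g (x + 0 *\<^sub>R (y - x)))) (at 0)"
    unfolding c_def
    by (rule has_real_derivative_along_path) (auto intro!: derivative_eq_intros)
  ultimately have "c 1 - c 0 \<ge> inner (y - x) (g x) * (1 - 0)"
    by (intro convex_on_imp_above_tangent[of UNIV]) auto
  then show ?thesis by (simp add: c_def)
qed

text \<open>Along the segment, \<open>f\<close> minus its quadratic model at \<open>x\<close> has
  nonpositive derivative, because the gradient changes by at most
  \<open>L * t * norm d\<close>.\<close>

lemma descent: "f y \<le> f x + inner (y - x) (g x) + L / 2 * (norm (y - x))\<^sup>2"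
proof -
  define d where "d = y - x"
  define c where "c t = f (x + t *\<^sub>R d) - t * inner d (g x) - L / 2 * t\<^sup>2 * (norm d)\<^sup>2" for t
  have "c 1 \<le> c 0"
  proof (rule DERIV_nonpos_imp_nonincreasing[of 0 1 c])
    fix t :: real assume t: "0 \<le> t"
    have "(c has_real_derivative
        inner d (g (x + t *\<^sub>R d)) - inner d (g x) - L * t * (norm d)\<^sup>2) (at t)"
    proof -
      have "((\<lambda>t. x + t *\<^sub>R d) has_vector_derivative d) (at t)"
        by (auto intro!: derivative_eq_intros)
      from has_real_derivative_along_path[OF this] show ?thesis
        unfolding c_def by (auto intro!: derivative_eq_intros simp: algebra_simps)
    qed
    moreover have "inner d (g (x + t *\<^sub>R d)) - inner d (g x) \<le> norm d * (L * norm (t *\<^sub>R d))"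
      using norm_cauchy_schwarz[of d "g (x + t *\<^sub>R d) - g x"]
        mult_left_mono[OF gradient_lipschitz[of "x + t *\<^sub>R d" x] norm_ge_zero[of d]]
      by (simp add: inner_diff_right)
    ultimately show "\<exists>y. (c has_real_derivative y) (at t) \<and> y \<le> 0"
      using t by (intro exI[of _ "inner d (g (x + t *\<^sub>R d)) - inner d (g x) - L * t * (norm d)\<^sup>2"])
        (simp add: power2_eq_square algebra_simps)
  qed simp
  then show ?thesis by (simp add: c_def d_def)
qed

text \<open>The step length \<open>1 / L\<close> minimizes the upper bound of \<open>descent\<close>
  along the negative gradient.\<close>

lemma gradient_step: "f (x - (1 / L) *\<^sub>R g x) \<le> f x - (norm (g x))\<^sup>2 / (2 * L)"
proof -
  have "f (x - (1 / L) *\<^sub>R g x)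
      \<le> f x - (1 / L) * (norm (g x))\<^sup>2 + L / 2 * ((1 / L) * norm (g x))\<^sup>2"
    using descent[of "x - (1 / L) *\<^sub>R g x" x] L_pos
    by (simp add: power2_norm_eq_inner[symmetric])
  also have "\<dots> = f x - (norm (g x))\<^sup>2 / (2 * L)"
    using L_pos by (simp add: field_simps power2_eq_square)
  finally show ?thesis .
qed

text \<open>A gradient step from \<open>y\<close> cannot fall below the minimum, so its guaranteed
  decrease is at most the gap at \<open>y\<close>.\<close>

lemma norm_gradient_le_gap: "(norm (g y))\<^sup>2 \<le> 2 * L * (f y - f xs)"
proof -
  have "(norm (g y))\<^sup>2 / (2 * L) \<le> f y - f xs"
    using gradient_step[of y] minimizer[of "y - (1 / L) *\<^sub>R g y"] by linarith
  then show ?thesis using L_pos by (simp add: field_simps)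
qed

lemma gradient_minimizer: "g xs = 0"
  using norm_gradient_le_gap[of xs] by simp

text \<open>The tangent at \<open>y\<close> is tested at \<open>xs + g y / L\<close>, where descent from the minimizer
  bounds \<open>f\<close> from above.\<close>

lemma gap_le_inner: "f y - f xs \<le> inner (y - xs) (g y) - (norm (g y))\<^sup>2 / (2 * L)"
proof -
  have "f (xs + (1 / L) *\<^sub>R g y) \<le> f xs + (norm (g y))\<^sup>2 / (2 * L)"
  proof -
    have "f (xs + (1 / L) *\<^sub>R g y) \<le> f xs + L / 2 * ((1 / L) * norm (g y))\<^sup>2"
      using descent[of "xs + (1 / L) *\<^sub>R g y" xs] L_pos by (simp add: gradient_minimizer)
    also have "\<dots> = f xs + (norm (g y))\<^sup>2 / (2 * L)"
      using L_pos by (simp add: field_simps power2_eq_square)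
    finally show ?thesis .
  qed
  moreover have "f (xs + (1 / L) *\<^sub>R g y)
      \<ge> f y + inner (xs - y) (g y) + (norm (g y))\<^sup>2 / L"
    using gradient_inequality[of y "xs + (1 / L) *\<^sub>R g y"]
    by (simp add: inner_diff_left inner_add_left power2_norm_eq_inner)
  moreover have "(norm (g y))\<^sup>2 / L = (norm (g y))\<^sup>2 / (2 * L) + (norm (g y))\<^sup>2 / (2 * L)"
    using L_pos by (simp add: field_simps)
  moreover have "inner (xs - y) (g y) = - inner (y - xs) (g y)"
    by (simp add: inner_diff_left)
  ultimately show ?thesis by linarith
qed

end

subsection \<open>Energy decay of the randomized flow\<close>

lemma norm_scaleR_diff_sq:
  "(norm (a *\<^sub>R u - b *\<^sub>R h))\<^sup>2 = a\<^sup>2 * (norm u)\<^sup>2 - 2 * a * b * inner u h + b\<^sup>2 * (norm h)\<^sup>2"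
  for u h :: "'a::real_inner"
  unfolding power2_norm_eq_inner
  by (simp add: inner_diff inner_commute[of h u] power2_eq_square algebra_simps)

text \<open>Collects the discretization errors of one step: \<open>R\<close> stands for
  \<open>sqrt B\<close>, \<open>a\<close> for \<open>B - A\<close>, \<open>n\<close> and
  \<open>N\<close> for the gradient norms at the sampled point and at the end point without kick,
  \<open>v\<close> for \<open>L\<close> times the norm of \<open>z - x\<close> at time
  \<open>A\<close>, \<open>\<theta>\<close> for \<open>1 - t\<^sup>2 / B\<^sup>2\<close>. With
  \<open>\<nu> = v / R\<close> the right-hand side is \<open>n\<^sup>2 + 2 * \<nu>\<^sup>2\<close>,
  and \<open>a\<^sup>2 \<le> R / 81\<close> turns every coefficient on the left into an absolute
  constant.\<close>

lemma quadratic_error_absorbed: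
  fixes a R n N v \<theta> :: real
  assumes R: "1 \<le> R" and a: "0 < a" "a\<^sup>2 \<le> R / 81"
    and nn: "0 \<le> n" "0 \<le> N" "0 \<le> v" "0 \<le> \<theta>"
    and \<theta>: "\<theta> \<le> 2 * a / R\<^sup>2" and N: "N \<le> n + \<theta> * v"
  shows "2 * a * (N * (\<theta> * v)) + a * (\<theta> * v)\<^sup>2 + a\<^sup>2 / R\<^sup>2 * (N * n) + a ^ 3 / R\<^sup>2 * n\<^sup>2
    + 8 * a / R\<^sup>2 * (v * n) \<le> n\<^sup>2 + 2 / R\<^sup>2 * v\<^sup>2"
proof -
  define \<nu> where "\<nu> = v / R"
  have v: "v = R * \<nu>" and \<nu>: "0 \<le> \<nu>" using R nn by (auto simp: \<nu>_def)
  have RR: "R \<le> R\<^sup>2" using R by (simp add: power2_eq_square)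
  have "a\<^sup>2 \<le> (R / 9)\<^sup>2"
    using a RR by (simp add: power_divide)
  then have aR: "a \<le> R / 9"
    by (rule power2_le_imp_le) (use R in simp)
  have a3: "a ^ 3 \<le> R\<^sup>2 / 729"
  proof -
    have "a\<^sup>2 * a \<le> R / 81 * (R / 9)" using a aR R by (intro mult_mono) auto
    then show ?thesis by (simp add: power2_eq_square power3_eq_cube)
  qed
  have m: "\<theta> * v \<le> 2 * a / R * \<nu>"
    using mult_right_mono[OF \<theta>, of v] nn R v by (simp add: power2_eq_square)
  have "2 * a / R \<le> 2 / 9" using aR R by (simp add: field_simps)
  from order_trans[OF m mult_right_mono[OF this \<nu>]]
  have N': "N \<le> n + 2 / 9 * \<nu>" using N by linarith
  have "2 * a * (N * (\<theta> * v)) \<le> 2 * a * (N * (2 * a / R * \<nu>))"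
    using m a nn by (intro mult_left_mono) auto
  also have "\<dots> = 4 * (a\<^sup>2 / R) * (N * \<nu>)" by (simp add: power2_eq_square)
  also have "\<dots> \<le> 4 / 81 * (N * \<nu>)"
    using a R nn \<nu> by (intro mult_right_mono) (auto simp: field_simps)
  finally have 1: "2 * a * (N * (\<theta> * v)) \<le> 4 / 81 * (N * \<nu>)" .
  have "a * (\<theta> * v)\<^sup>2 \<le> a * (2 * a / R * \<nu>)\<^sup>2"
    using m a nn by (intro mult_left_mono power_mono) auto
  also have "\<dots> = 4 * (a ^ 3 / R\<^sup>2) * \<nu>\<^sup>2"
    by (simp add: power2_eq_square power3_eq_cube)
  also have "\<dots> \<le> 4 / 729 * \<nu>\<^sup>2"
    using a3 R by (intro mult_right_mono) (auto simp: field_simps)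
  finally have 2: "a * (\<theta> * v)\<^sup>2 \<le> 4 / 729 * \<nu>\<^sup>2" .
  have "a\<^sup>2 / R\<^sup>2 \<le> 1 / 81" using a RR R by (simp add: field_simps)
  then have 3: "a\<^sup>2 / R\<^sup>2 * (N * n) \<le> 1 / 81 * (N * n)"
    using nn by (intro mult_right_mono) auto
  have 4: "a ^ 3 / R\<^sup>2 * n\<^sup>2 \<le> 1 / 729 * n\<^sup>2"
    using a3 R by (intro mult_right_mono) (auto simp: field_simps)
  have "8 * a / R\<^sup>2 * (v * n) = 8 * (a / R) * (\<nu> * n)"
    using R by (simp add: v power2_eq_square)
  also have "\<dots> \<le> 8 / 9 * (\<nu> * n)"
    using aR R nn \<nu> by (intro mult_right_mono) (auto simp: field_simps)
  finally have 5: "8 * a / R\<^sup>2 * (v * n) \<le> 8 / 9 * (\<nu> * n)" .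
  have 6: "2 / R\<^sup>2 * v\<^sup>2 = 2 * \<nu>\<^sup>2" using R by (simp add: v power_mult_distrib)
  have 7: "N * \<nu> \<le> n * \<nu> + 2 / 9 * \<nu>\<^sup>2"
    using mult_right_mono[OF N' \<nu>] by (simp add: algebra_simps power2_eq_square)
  have 8: "N * n \<le> n\<^sup>2 + 2 / 9 * (n * \<nu>)"
    using mult_right_mono[OF N' nn(1)] by (simp add: algebra_simps power2_eq_square)
  \<comment> \<open>After \<open>7\<close> and \<open>8\<close> the product \<open>n * \<nu>\<close>
    has total coefficient 686/729, less than 1, so this bound absorbs it with room for the remaining
    squares.\<close>
  have 9: "2 * (n * \<nu>) \<le> n\<^sup>2 + \<nu>\<^sup>2"
    using sum_squares_bound[of n \<nu>] by simp
  have "\<nu> * n = n * \<nu>" by simp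
  with 1 2 3 4 5 6 7 8 9 zero_le_power2[of n] zero_le_power2[of \<nu>]
  show ?thesis by linarith
qed

section \<open>Ballistic motion, kicks and the one-step energy estimate\<close>

context smooth_convex
begin

text \<open>Between two kicks the point moves ballistically, \<open>x' = 2 (z - x) / t\<close> with \<open>z\<close> fixed,
  so that \<open>z - x\<close> is proportional to \<open>1 / t\<^sup>2\<close>. A state is the pair \<open>(x, z)\<close> at time \<open>A\<close>.\<close>

definition position :: "real \<Rightarrow> 'a \<times> 'a \<Rightarrow> real \<Rightarrow> 'a" where
  "position A s t = snd s + (A\<^sup>2 / t\<^sup>2) *\<^sub>R (fst s - snd s)"

text \<open>One gradient, taken at the sampled time \<open>t\<close>, is weighted by the whole
  length \<open>B - A\<close>: for uniform \<open>t\<close> the mean jump is the integral of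
  \<open>- g / (2 * L)\<close> along the ballistic path.\<close>

definition kick :: "real \<Rightarrow> real \<Rightarrow> 'a \<times> 'a \<Rightarrow> real \<Rightarrow> 'a" where
  "kick A B s t = snd s - ((B - A) / (2 * L)) *\<^sub>R g (position A s t)"

text \<open>The factor \<open>t\<^sup>2 / B\<^sup>2\<close> is the inverse-square law of
  \<open>position\<close> again, now from \<open>t\<close> to \<open>B\<close> and around the kicked
  \<open>z\<close>.\<close>

definition advance :: "real \<Rightarrow> real \<Rightarrow> 'a \<times> 'a \<Rightarrow> real \<Rightarrow> 'a \<times> 'a" where
  "advance A B s t =
    (kick A B s t + (t\<^sup>2 / B\<^sup>2) *\<^sub>R (position A s t - kick A B s t), kick A B s t)"

text \<open>Along the flow the derivatives of the three summands add up to \<open>f x - f xs - inner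
  (x - xs) (g x) - 4 * L * (norm (z - x))\<^sup>2 / t\<close>: the last summand cancels the cross
  term \<open>inner (z - x) (g x)\<close> and supplies dissipation.\<close>

definition energy :: "real \<Rightarrow> 'a \<times> 'a \<Rightarrow> real" where
  "energy A s = A * (f (fst s) - f xs) + L * (norm (snd s - xs))\<^sup>2
    + L * (norm (snd s - fst s))\<^sup>2"

lemma energy_nonneg: "0 \<le> A \<Longrightarrow> 0 \<le> energy A s"
  using minimizer[of "fst s"] L_pos by (simp add: energy_def)

text \<open>This is the derivative in \<open>t\<close> of
  \<open>t * (f (position A s t) - f xs)\<close>, so its integral depends only on the end
  values.\<close>

definition drift_rate :: "real \<Rightarrow> 'a \<times> 'a \<Rightarrow> real \<Rightarrow> real" where
  "drift_rate A s t = f (position A s t) - f xs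
    + 2 * (A\<^sup>2 / t\<^sup>2) * inner (snd s - fst s) (g (position A s t))"

lemma position_self: "A \<noteq> 0 \<Longrightarrow> position A s A = fst s"
  by (simp add: position_def)

lemma has_integral_drift_rate:
  assumes "0 < A" "A \<le> B"
  shows "(drift_rate A s has_integral
    B * (f (position A s B) - f xs) - A * (f (fst s) - f xs)) {A..B}"
proof -
  let ?F = "\<lambda>t. t * (f (position A s t) - f xs)"
  have "(?F has_vector_derivative drift_rate A s t) (at t within {A..B})" if "t \<in> {A..B}" for t
  proof -
    have t: "t > 0" using assms that by auto
    have "((\<lambda>t. A\<^sup>2 / t\<^sup>2) has_real_derivative - 2 * A\<^sup>2 / t ^ 3) (at t within {A..B})"
      using t by (auto intro!: derivative_eq_intros simp: field_simps eval_nat_numeral)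
    from has_vector_derivative_scaleR[OF this has_vector_derivative_const[of "fst s - snd s"]]
    have "(position A s has_vector_derivative (- 2 * A\<^sup>2 / t ^ 3) *\<^sub>R (fst s - snd s))
        (at t within {A..B})"
      unfolding position_def[abs_def]
      by (subst add.commute, subst has_vector_derivative_add_const) simp
    from has_real_derivative_along_path[OF this]
    have "(?F has_real_derivative (f (position A s t) - f xs)
        + t * inner ((- 2 * A\<^sup>2 / t ^ 3) *\<^sub>R (fst s - snd s)) (g (position A s t))) (at t within {A..B})"
      by (auto intro!: derivative_eq_intros)
    moreover have "inner ((- 2 * A\<^sup>2 / t ^ 3) *\<^sub>R (fst s - snd s)) (g (position A s t))
        = 2 * A\<^sup>2 / t ^ 3 * inner (snd s - fst s) (g (position A s t))"
      by (simp only: inner_scaleR_left minus_diff_eq[of "snd s" "fst s", symmetric] inner_minus_left)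
    moreover have "t * (2 * A\<^sup>2 / t ^ 3 * inner (snd s - fst s) (g (position A s t)))
        = 2 * (A\<^sup>2 / t\<^sup>2) * inner (snd s - fst s) (g (position A s t))"
      using t by (simp add: field_simps eval_nat_numeral)
    ultimately show ?thesis
      unfolding drift_rate_def has_real_derivative_iff_has_vector_derivative by metis
  qed
  from fundamental_theorem_of_calculus[OF \<open>A \<le> B\<close> this]
  show ?thesis using assms by (simp add: position_self)
qed

text \<open>The last summand has mean zero over \<open>t \<in> {A..B}\<close>, and the mean of \<open>drift_rate\<close> cancels the
  bracket, so averaging over \<open>t\<close> leaves \<open>energy A s\<close>. The squared gradient produced by the kick is
  of order \<open>(B - A)\<^sup>2\<close> and could not be absorbed by the dissipation; what saves the estimate is that
  moving the point from \<open>position A s B\<close> by the kick decreases \<open>B * f\<close> by the same amount on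
  average.\<close>

lemma energy_advance_le:
  assumes A: "0 < A" and B: "1 \<le> B" and a: "A < B" "(B - A)\<^sup>2 \<le> sqrt B / 81"
    and t: "t \<in> {A..B}"
  shows "energy B (advance A B s t) \<le> energy A s
    + (B * (f (position A s B) - f xs) - A * (f (fst s) - f xs))
    - (B - A) * drift_rate A s t
    + (B - A) * (norm (g (position A s B)))\<^sup>2 / (2 * L) * ((B - A) - 2 * (B - t))"
proof -
  \<comment> \<open>In what follows \<open>x\<close> is the sampled point, \<open>yB\<close> the
    point reached at \<open>B\<close> without a kick, \<open>(y', z')\<close> the actual new state,
    and \<open>\<gamma>\<close>, \<open>\<tau>\<close> are the ballistic contraction factors from
    \<open>A\<close> to \<open>t\<close> and from \<open>t\<close> to \<open>B\<close>.\<close>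
  define y z a q \<kappa> where "y = fst s" and "z = snd s" and "a = B - A" and "q = B - t"
    and "\<kappa> = a / (2 * L)"
  define w x yB where "w = z - y" and "x = position A s t" and "yB = position A s B"
  define G h where "G = g yB" and "h = g x"
  define \<gamma> \<tau> \<theta> where "\<gamma> = A\<^sup>2 / t\<^sup>2" and "\<tau> = t\<^sup>2 / B\<^sup>2" and "\<theta> = 1 - \<tau>"
  define z' y' where "z' = z - \<kappa> *\<^sub>R h" and "y' = z' + \<tau> *\<^sub>R (x - z')"
  define n N v i c where "n = norm h" and "N = norm G" and "v = L * norm w"
    and "i = inner h G" and "c = inner w h"
  have pos: "t > 0" "a > 0" "B > 0" "L > 0" "\<kappa> > 0" "0 \<le> q" "q \<le> a"
    using A B a t L_pos by (auto simp: a_def q_def \<kappa>_def)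
  have \<gamma>: "0 \<le> \<gamma>" "\<gamma> \<le> 1" and \<tau>: "0 \<le> \<tau>" "\<tau> \<le> 1" and \<theta>: "0 \<le> \<theta>"
    using A B t by (auto simp: \<gamma>_def \<tau>_def \<theta>_def)
  have B\<theta>: "B * \<theta> = 2 * q - q\<^sup>2 / B"
    using pos by (simp add: \<theta>_def \<tau>_def q_def field_simps power2_eq_square)
  have \<theta>le: "\<theta> \<le> 2 * a / B"
  proof -
    have "B * \<theta> \<le> 2 * a" using B\<theta> pos by (smt (verit) zero_le_divide_iff zero_le_power2)
    then show ?thesis using pos by (simp add: field_simps)
  qed
  have \<rho>: "A\<^sup>2 / B\<^sup>2 = \<gamma> * \<tau>" using pos by (simp add: \<gamma>_def \<tau>_def)
  have x: "x = z - \<gamma> *\<^sub>R w"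
    by (simp add: x_def position_def \<gamma>_def w_def y_def z_def algebra_simps)
  have yB: "yB = z - (\<gamma> * \<tau>) *\<^sub>R w"
    by (simp add: yB_def position_def \<rho> w_def y_def z_def algebra_simps)
  have adv: "advance A B s t = (y', z')"
    by (simp add: advance_def kick_def y'_def z'_def \<tau>_def \<kappa>_def a_def z_def h_def x_def)

  \<comment> \<open>The kick displaces the end point only by this vector. Descent is applied at
    \<open>yB\<close>, not at \<open>x\<close>; the resulting term
    \<open>- B * \<theta> * \<kappa> * i\<close> counteracts the squared gradients that the kick
    creates in the other two summands of the energy.\<close>
  have y'yB: "y' - yB = - (\<theta> * \<kappa>) *\<^sub>R h"
    by (simp add: y'_def z'_def x yB \<theta>_def algebra_simps)
  have D1: "f y' \<le> f yB - \<theta> * \<kappa> * i + L / 2 * (\<theta> * \<kappa>)\<^sup>2 * n\<^sup>2"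
    using descent[of y' yB] unfolding y'yB G_def[symmetric]
    by (simp add: i_def n_def power_mult_distrib)
  have D2: "(norm (z' - xs))\<^sup>2 = (norm (z - xs))\<^sup>2 - 2 * \<kappa> * inner (z - xs) h + \<kappa>\<^sup>2 * n\<^sup>2"
  proof -
    have "z' - xs = (z - xs) - \<kappa> *\<^sub>R h" by (simp add: z'_def)
    then show ?thesis
      using norm_scaleR_diff_sq[of 1 "z - xs" \<kappa> h] by (simp only: n_def) simp
  qed
  have D3: "(norm (z' - y'))\<^sup>2 = (\<gamma> * \<tau>)\<^sup>2 * (norm w)\<^sup>2 - 2 * (\<gamma> * \<tau>) * (\<tau> * \<kappa>) * c + (\<tau> * \<kappa>)\<^sup>2 * n\<^sup>2"
  proof -
    have "z' - y' = (\<gamma> * \<tau>) *\<^sub>R w - (\<tau> * \<kappa>) *\<^sub>R h"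
      by (simp add: y'_def z'_def x algebra_simps)
    then show ?thesis
      using norm_scaleR_diff_sq[of "\<gamma> * \<tau>" w "\<tau> * \<kappa>" h] by (simp add: n_def c_def)
  qed
  \<comment> \<open>Convexity enters here, in the sharpened form whose term
    \<open>- n\<^sup>2 / (2 * L)\<close> later pays for the errors.\<close>
  have D4: "f x - f xs \<le> inner (z - xs) h - \<gamma> * c - n\<^sup>2 / (2 * L)"
  proof -
    have "x - xs = (z - xs) - \<gamma> *\<^sub>R w" by (simp add: x)
    then show ?thesis using gap_le_inner[of x] unfolding h_def[symmetric]
      by (simp add: c_def n_def inner_diff_left)
  qed

  \<comment> \<open>The sampled gradient \<open>h\<close> is compared with \<open>G\<close>, which
    does not depend on \<open>t\<close>. In \<open>K2\<close> all multiples of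
    \<open>N\<^sup>2\<close> then cancel against the mean-zero term of the claim, and only errors
    controlled by \<open>e\<close> and by \<open>q\<^sup>2 / B\<close> remain.\<close>
  define e where "e = h - G"
  define j m where "j = inner G e" and "m = norm e"
  have h: "h = G + e" by (simp add: e_def)
  have n2: "n\<^sup>2 = N\<^sup>2 + 2 * j + m\<^sup>2" and i2: "i = N\<^sup>2 + j"
    unfolding n_def N_def m_def j_def i_def h
    by (simp_all add: power2_norm_eq_inner inner_add inner_commute)
  have m: "m \<le> \<theta> * v"
  proof -
    have "m \<le> L * norm (x - yB)"
      unfolding m_def e_def h_def G_def by (rule gradient_lipschitz)
    also have "x - yB = - ((\<gamma> * \<theta>) *\<^sub>R w)" by (simp add: x yB \<theta>_def algebra_simps)
    also have "L * norm \<dots> = \<gamma> * (\<theta> * v)"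
      using \<gamma> \<theta> by (simp add: v_def abs_mult)
    also have "\<dots> \<le> 1 * (\<theta> * v)"
      using \<gamma> \<theta> pos by (intro mult_right_mono) (auto simp: v_def)
    finally show ?thesis by simp
  qed
  have nn: "0 \<le> n" "0 \<le> N" "0 \<le> v" "0 \<le> m" using pos by (auto simp: n_def N_def v_def m_def)
  have Nle: "N \<le> n + \<theta> * v"
    using m norm_triangle_ineq4[of h e] by (simp add: N_def n_def m_def e_def)

  \<comment> \<open>Up to the factor \<open>a / (2 * L)\<close>, \<open>K\<close> bounds the
    difference of the two sides of the claim once \<open>D1\<close> to \<open>D4\<close> are
    inserted.\<close>
  define K where "K = - (B * \<theta>) * i + B * \<theta>\<^sup>2 * a / 4 * n\<^sup>2 + a / 2 * (1 + \<tau>\<^sup>2) * n\<^sup>2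
    - 2 / a * (1 - (\<gamma> * \<tau>)\<^sup>2) * v\<^sup>2 + 2 * \<gamma> * (1 - \<tau>\<^sup>2) * (L * c) - n\<^sup>2 - (a - 2 * q) * N\<^sup>2"
  have K1: "a / 2 * (1 + \<tau>\<^sup>2) * n\<^sup>2 \<le> a * n\<^sup>2"
  proof -
    have "\<tau>\<^sup>2 \<le> 1" using \<tau> by (simp add: power_le_one)
    then have "a / 2 * (1 + \<tau>\<^sup>2) \<le> a / 2 * 2" using pos by (intro mult_left_mono) auto
    then show ?thesis by (intro mult_right_mono) auto
  qed
  have K2: "a * n\<^sup>2 - (B * \<theta>) * i - (a - 2 * q) * N\<^sup>2
      \<le> 2 * a * (N * (\<theta> * v)) + a * (\<theta> * v)\<^sup>2 + a\<^sup>2 / B * (N * n)"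
  proof -
    have "a * n\<^sup>2 - (B * \<theta>) * i - (a - 2 * q) * N\<^sup>2 = 2 * (a - q) * j + a * m\<^sup>2 + q\<^sup>2 / B * i"
      unfolding B\<theta> n2 by (simp add: i2 algebra_simps)
    moreover have "2 * (a - q) * j \<le> 2 * a * (N * (\<theta> * v))"
    proof -
      have "j \<le> N * m" unfolding j_def N_def m_def by (rule norm_cauchy_schwarz)
      also have "\<dots> \<le> N * (\<theta> * v)" using m nn by (intro mult_left_mono) auto
      finally have "2 * (a - q) * j \<le> 2 * (a - q) * (N * (\<theta> * v))"
        using pos by (intro mult_left_mono) auto
      also have "\<dots> \<le> 2 * a * (N * (\<theta> * v))"
        using pos nn \<theta> by (intro mult_right_mono) auto
      finally show ?thesis .
    qed
    moreover have "a * m\<^sup>2 \<le> a * (\<theta> * v)\<^sup>2"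
      using m nn pos by (intro mult_left_mono power_mono) auto
    moreover have "q\<^sup>2 / B * i \<le> a\<^sup>2 / B * (N * n)"
    proof -
      have "i \<le> N * n" unfolding i_def N_def n_def
        by (metis inner_commute norm_cauchy_schwarz)
      then have "q\<^sup>2 / B * i \<le> q\<^sup>2 / B * (N * n)" using pos by (intro mult_left_mono) auto
      also have "\<dots> \<le> a\<^sup>2 / B * (N * n)"
        using pos nn by (intro mult_right_mono divide_right_mono power_mono) auto
      finally show ?thesis .
    qed
    ultimately show ?thesis by linarith
  qed
  have K3: "B * \<theta>\<^sup>2 * a / 4 * n\<^sup>2 \<le> a ^ 3 / B * n\<^sup>2"
  proof -
    have "B * \<theta>\<^sup>2 * a / 4 \<le> B * (2 * a / B)\<^sup>2 * a / 4"
      using \<theta> \<theta>le pos by (intro divide_right_mono mult_right_mono mult_left_mono power_mono) auto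
    also have "\<dots> = a ^ 3 / B" using pos by (simp add: power2_eq_square power3_eq_cube)
    finally show ?thesis by (intro mult_right_mono) auto
  qed
  \<comment> \<open>The contraction of \<open>z - x\<close> over the step supplies this dissipation:
    \<open>(\<gamma> * \<tau>)\<^sup>2 \<le> A / B\<close>, and
    \<open>(1 - A / B) / a = 1 / B\<close>.\<close>
  have K4: "2 / B * v\<^sup>2 \<le> 2 / a * (1 - (\<gamma> * \<tau>)\<^sup>2) * v\<^sup>2"
  proof -
    have r: "\<gamma> * \<tau> \<le> A / B" "0 \<le> \<gamma> * \<tau>"
      unfolding \<rho>[symmetric] power_divide[symmetric] using A a pos
      by (simp_all add: power2_eq_square mult_le_one field_simps)
    have "A / B \<le> 1" using a pos by simp
    then have "(\<gamma> * \<tau>)\<^sup>2 \<le> A / B"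
      using r mult_mono[OF r(1) order_trans[OF r(1)]] A pos by (fastforce simp: power2_eq_square)
    then have "2 / a * (1 - A / B) \<le> 2 / a * (1 - (\<gamma> * \<tau>)\<^sup>2)"
      using pos by (intro mult_left_mono) auto
    moreover have "2 / a * (1 - A / B) = 2 / B"
      using pos A by (simp add: a_def field_simps)
    ultimately show ?thesis by (intro mult_right_mono) auto
  qed
  \<comment> \<open>The cross terms from the drift rate, \<open>D3\<close> and \<open>D4\<close>
    cancel up to the factor \<open>1 - \<tau>\<^sup>2\<close>, which is at most
    \<open>4 * a / B\<close>.\<close>
  have K5: "2 * \<gamma> * (1 - \<tau>\<^sup>2) * (L * c) \<le> 8 * a / B * (v * n)"
  proof -
    have "1 - \<tau>\<^sup>2 = \<theta> * (1 + \<tau>)" by (simp add: \<theta>_def power2_eq_square algebra_simps)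
    also have "\<dots> \<le> (2 * a / B) * 2" using \<theta> \<theta>le \<tau> pos by (intro mult_mono) auto
    finally have "\<gamma> * (1 - \<tau>\<^sup>2) \<le> 1 * (4 * a / B)"
      using \<gamma> pos \<tau> by (intro mult_mono) (auto simp: power_le_one)
    moreover have "L * c \<le> v * n"
      using norm_cauchy_schwarz[of w h] pos by (simp add: c_def v_def n_def)
    moreover have "0 \<le> \<gamma> * (1 - \<tau>\<^sup>2)" using \<gamma> \<tau> by (simp add: power_le_one)
    ultimately have "\<gamma> * (1 - \<tau>\<^sup>2) * (L * c) \<le> 1 * (4 * a / B) * (v * n)"
      using mult_left_mono[of "L * c" "v * n" "\<gamma> * (1 - \<tau>\<^sup>2)"]
        mult_right_mono[of "\<gamma> * (1 - \<tau>\<^sup>2)" "1 * (4 * a / B)" "v * n"] nn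
      by (meson mult_nonneg_nonneg order_trans)
    then show ?thesis by linarith
  qed
  have K6: "2 * a * (N * (\<theta> * v)) + a * (\<theta> * v)\<^sup>2 + a\<^sup>2 / B * (N * n) + a ^ 3 / B * n\<^sup>2
      + 8 * a / B * (v * n) \<le> n\<^sup>2 + 2 / B * v\<^sup>2"
    using quadratic_error_absorbed[of "sqrt B" a n N v \<theta>] B a nn \<theta> \<theta>le Nle pos
    by (simp add: a_def)
  \<comment> \<open>With one variable for each product, combining \<open>K1\<close> to
    \<open>K6\<close> is a linear matter.\<close>
  have "- b + c3 + c1 - c4 + c5 - n' - d \<le> 0"
    if "c1 \<le> an" "an - b - d \<le> e1 + e2 + e3" "c3 \<le> e4" "e5 \<le> c4" "c5 \<le> e6"
      "e1 + e2 + e3 + e4 + e6 \<le> n' + e5"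
    for b c1 c3 c4 c5 n' d an e1 e2 e3 e4 e5 e6 :: real
    using that by linarith
  from this[OF K1 K2 K3 K4 K5 K6] have "K \<le> 0"
    by (simp add: K_def)
  then have K: "a / (2 * L) * K \<le> 0"
    using pos by (intro mult_nonneg_nonpos) auto
  have D1': "B * (f y' - f xs) \<le> B * (f yB - \<theta> * \<kappa> * i + L / 2 * (\<theta> * \<kappa>)\<^sup>2 * n\<^sup>2 - f xs)"
    using D1 pos by (intro mult_left_mono) auto
  have D4': "a * (f x - f xs) \<le> a * (inner (z - xs) h - \<gamma> * c - n\<^sup>2 / (2 * L))"
    using D4 pos by (intro mult_left_mono) auto
  have KK: "a / (2 * L) * K = B * (- \<theta> * \<kappa> * i + L / 2 * (\<theta> * \<kappa>)\<^sup>2 * n\<^sup>2)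
      + L * (\<kappa>\<^sup>2 * n\<^sup>2 + (\<tau> * \<kappa>)\<^sup>2 * n\<^sup>2)
      - L * (1 - (\<gamma> * \<tau>)\<^sup>2) * (norm w)\<^sup>2 + a * \<gamma> * (1 - \<tau>\<^sup>2) * c
      - a * n\<^sup>2 / (2 * L) - a * N\<^sup>2 / (2 * L) * (a - 2 * q)"
    unfolding K_def \<kappa>_def v_def using pos by (simp add: field_simps power2_eq_square)
  define Z where "Z = inner (z - xs) h"
  have D2': "L * (norm (z' - xs))\<^sup>2 = L * (norm (z - xs))\<^sup>2 - a * Z + L * (\<kappa>\<^sup>2 * n\<^sup>2)"
    unfolding D2 Z_def[symmetric] using pos by (simp add: \<kappa>_def field_simps)
  have D3': "L * (norm (z' - y'))\<^sup>2
      = L * (\<gamma> * \<tau>)\<^sup>2 * (norm w)\<^sup>2 - a * \<gamma> * \<tau>\<^sup>2 * c + L * ((\<tau> * \<kappa>)\<^sup>2 * n\<^sup>2)"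
    unfolding D3 using pos by (simp add: \<kappa>_def field_simps power2_eq_square)
  have E1: "energy B (y', z') = B * (f y' - f xs) + L * (norm (z' - xs))\<^sup>2 + L * (norm (z' - y'))\<^sup>2"
    by (simp add: energy_def)
  have E2: "energy A s = A * (f y - f xs) + L * (norm (z - xs))\<^sup>2 + L * (norm w)\<^sup>2"
    by (simp add: energy_def y_def z_def w_def)
  have E3: "drift_rate A s t = f x - f xs + 2 * \<gamma> * c"
    by (simp add: drift_rate_def x_def \<gamma>_def c_def w_def z_def y_def h_def)
  have "B * (f y' - f xs) + L * (norm (z' - xs))\<^sup>2 + L * (norm (z' - y'))\<^sup>2
      \<le> A * (f y - f xs) + L * (norm (z - xs))\<^sup>2 + L * (norm w)\<^sup>2
        + (B * (f yB - f xs) - A * (f y - f xs)) - a * (f x - f xs + 2 * \<gamma> * c)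
        + a * N\<^sup>2 / (2 * L) * (a - 2 * q)"
    unfolding D2' D3' using D1' D4'[folded Z_def] K[unfolded KK]
    by (simp add: algebra_simps)
  then show ?thesis
    by (simp only: adv E1 E2 E3 x_def[symmetric] yB_def[symmetric] G_def[symmetric]
      N_def[symmetric] a_def[symmetric] q_def[symmetric] y_def[symmetric])
qed

section \<open>Averaging over the sampled time\<close>

lemma continuous_on_position:
  "0 < A \<Longrightarrow> continuous_on {A..B} (position A s)"
  unfolding position_def[abs_def] by (intro continuous_intros) auto

lemma measurable_gradient [measurable]: "g \<in> borel_measurable borel"
  by (intro borel_measurable_continuous_onI continuous_gradient)

lemma measurable_f [measurable]: "f \<in> borel_measurable borel"
  by (intro borel_measurable_continuous_onI continuous_f)

lemma measurable_position [measurable]: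
  "(\<lambda>(s, t). position A s t) \<in> borel_measurable (borel \<Otimes>\<^sub>M borel)"
  unfolding position_def case_prod_beta borel_prod[symmetric] by measurable

lemma measurable_advance [measurable]:
  "(\<lambda>(s, t). advance A B s t) \<in> borel \<Otimes>\<^sub>M borel \<rightarrow>\<^sub>M borel"
  using measurable_position
  unfolding advance_def kick_def case_prod_beta borel_prod[symmetric] by measurable

lemma measurable_energy [measurable]: "energy A \<in> borel_measurable borel"
  unfolding energy_def[abs_def] borel_prod[symmetric] by measurable

lemma integral_energy_advance_le:
  assumes A: "0 < A" and B: "1 \<le> B" and a: "A < B" "(B - A)\<^sup>2 \<le> sqrt B / 81"
  obtains I where "((\<lambda>t. energy B (advance A B s t)) has_integral I) {A..B}"
    "I \<le> (B - A) * energy A s"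
proof -
  have cp: "continuous_on {A..B} (position A s)" by (rule continuous_on_position[OF A])
  have cg: "continuous_on {A..B} (\<lambda>t. g (position A s t))"
    by (rule continuous_on_compose2[OF continuous_gradient[of UNIV] cp]) simp
  have ck: "continuous_on {A..B} (kick A B s)"
    unfolding kick_def[abs_def] by (intro continuous_intros cg)
  have c1: "continuous_on {A..B} (\<lambda>t. fst (advance A B s t))"
    unfolding advance_def fst_conv using A B by (intro continuous_intros cp ck) auto
  have c2: "continuous_on {A..B} (\<lambda>t. snd (advance A B s t))"
    unfolding advance_def snd_conv by (rule ck)
  have "continuous_on {A..B} (\<lambda>t. energy B (advance A B s t))"
    unfolding energy_def
    by (intro continuous_on_add continuous_on_mult continuous_on_diff continuous_on_power
      continuous_on_norm continuous_on_const continuous_on_compose2[OF continuous_f[of UNIV] c1] c1 c2) auto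
  then obtain I where I: "((\<lambda>t. energy B (advance A B s t)) has_integral I) {A..B}"
    using integrable_continuous_interval by blast
  let ?D = "B * (f (position A s B) - f xs) - A * (f (fst s) - f xs)"
  let ?c = "(B - A) * (norm (g (position A s B)))\<^sup>2 / (2 * L)"
  \<comment> \<open>The antiderivative \<open>(B - A) * t + (B - t)\<^sup>2\<close> equals
    \<open>(B - A) * B\<close> at both ends, so this integral vanishes.\<close>
  have q: "((\<lambda>t. (B - A) - 2 * (B - t)) has_integral
      ((B - A) * B + (B - B)\<^sup>2) - ((B - A) * A + (B - A)\<^sup>2)) {A..B}"
    using a by (intro fundamental_theorem_of_calculus)
      (auto simp: has_real_derivative_iff_has_vector_derivative[symmetric] intro!: derivative_eq_intros)
  have "((\<lambda>t. energy A s + ?D - (B - A) * drift_rate A s t + ?c * ((B - A) - 2 * (B - t)))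
      has_integral ((B - A) * (energy A s + ?D) - (B - A) * ?D
        + ?c * (((B - A) * B + (B - B)\<^sup>2) - ((B - A) * A + (B - A)\<^sup>2)))) {A..B}"
    using a has_integral_const_real[of "energy A s + ?D" A B]
    by (intro has_integral_add has_integral_diff has_integral_mult_right q
      has_integral_drift_rate A) auto
  also have "(B - A) * (energy A s + ?D) - (B - A) * ?D
        + ?c * (((B - A) * B + (B - B)\<^sup>2) - ((B - A) * A + (B - A)\<^sup>2)) = (B - A) * energy A s"
  proof -
    have "((B - A) * B + (B - B)\<^sup>2) - ((B - A) * A + (B - A)\<^sup>2) = 0"
      by (simp add: power2_eq_square algebra_simps)
    then show ?thesis by (simp only:) (simp add: algebra_simps)
  qed
  finally have "I \<le> (B - A) * energy A s"
    by (rule has_integral_le[OF I]) (rule energy_advance_le[OF assms])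
  with I show ?thesis by (rule that)
qed

text \<open>The one-step supermartingale property at a frozen state \<open>s\<close>, in the form of
  the drift condition of the maximal inequality.\<close>

lemma nn_integral_energy_advance_le:
  assumes A: "0 < A" and B: "1 \<le> B" and a: "A < B" "(B - A)\<^sup>2 \<le> sqrt B / 81"
  shows "(\<integral>\<^sup>+t. ennreal (energy B (advance A B s t)) \<partial>uniform_measure lborel {A<..<B})
    \<le> ennreal (energy A s)"
proof -
  from integral_energy_advance_le[OF assms] obtain I
    where I: "((\<lambda>t. energy B (advance A B s t)) has_integral I) {A..B}"
      and le: "I \<le> (B - A) * energy A s" by blast
  have m: "(\<lambda>t. ennreal (energy B (advance A B s t))) \<in> borel_measurable lborel"
    by measurable
  have "(\<integral>\<^sup>+t. ennreal (energy B (advance A B s t)) \<partial>uniform_measure lborel {A<..<B})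
      = (\<integral>\<^sup>+t. ennreal (energy B (advance A B s t)) * indicator {A<..<B} t \<partial>lborel) / ennreal (B - A)"
    using nn_integral_uniform_measure[OF m, of "{A<..<B}"] a by simp
  also have "\<dots> \<le> (\<integral>\<^sup>+t. ennreal (energy B (advance A B s t)) * indicator {A..B} t \<partial>lborel) / ennreal (B - A)"
    by (intro divide_right_mono_ennreal nn_integral_mono) (auto simp: indicator_def)
  also have "\<dots> = ennreal I / ennreal (B - A)"
    using nn_integral_has_integral_lebesgue'[OF _ I] energy_nonneg[of B] B by simp
  also have "\<dots> \<le> ennreal ((B - A) * energy A s) / ennreal (B - A)"
    using le by (intro divide_right_mono_ennreal ennreal_leI)
  also have "\<dots> = ennreal (energy A s)"
    using a A energy_nonneg[of A s] by (simp add: divide_ennreal)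
  finally show ?thesis .
qed

end

subsection \<open>Maximal inequality for randomly driven recursions\<close>

text \<open>The path is a function of one realization \<open>p\<close>; random paths arise by
  inserting the samples. State \<open>k\<close> has consumed only \<open>p 0\<close> to
  \<open>p (k - 1)\<close>, so independent samples leave \<open>p k\<close> fresh for the next
  step.\<close>

primrec markov_path :: "(nat \<Rightarrow> 's \<Rightarrow> real \<Rightarrow> 's) \<Rightarrow> 's \<Rightarrow> (nat \<Rightarrow> real) \<Rightarrow> nat \<Rightarrow> 's" where
  "markov_path F s p 0 = s"
| "markov_path F s p (Suc k) = F k (markov_path F s p k) (p k)"

lemma markov_path_cong:
  assumes "\<And>i. i < k \<Longrightarrow> p i = q i"
  shows "markov_path F s p k = markov_path F s q k"
  using assms by (induction k) auto

lemma measurable_markov_path: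
  assumes F: "\<And>k. (\<lambda>(s, t). F k s t) \<in> N \<Otimes>\<^sub>M borel \<rightarrow>\<^sub>M N" and "s \<in> space N" and "k \<le> n"
  shows "(\<lambda>p. markov_path F s p k) \<in> PiM {..<n} (\<lambda>_. borel) \<rightarrow>\<^sub>M N"
  using \<open>k \<le> n\<close>
proof (induction k)
  case 0
  then show ?case using \<open>s \<in> space N\<close> by simp
next
  case (Suc k)
  have "(\<lambda>p. (markov_path F s p k, p k)) \<in> PiM {..<n} (\<lambda>_. borel) \<rightarrow>\<^sub>M N \<Otimes>\<^sub>M borel"
    using Suc by (intro measurable_Pair measurable_component_singleton) auto
  from measurable_compose[OF this F[of k]] show ?case by simp
qed

context prob_space
begin

text \<open>Takes the place of conditioning on the past: by independence the joint law of past and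
  present is a product, and Fubini integrates the present out first.\<close>

lemma nn_integral_past_present:
  fixes u :: "nat \<Rightarrow> 'a \<Rightarrow> real"
  assumes indep: "indep_vars (\<lambda>_. borel) u UNIV"
    and H: "H \<in> borel_measurable (PiM {..<n} (\<lambda>_. borel) \<Otimes>\<^sub>M borel)"
  shows "(\<integral>\<^sup>+\<omega>. H (\<lambda>i\<in>{..<n}. u i \<omega>, u n \<omega>) \<partial>M)
    = (\<integral>\<^sup>+\<omega>. (\<integral>\<^sup>+t. H (\<lambda>i\<in>{..<n}. u i \<omega>, t) \<partial>distr M borel (u n)) \<partial>M)"
proof -
  let ?P = "PiM {..<n} (\<lambda>_. borel) :: (nat \<Rightarrow> real) measure"
  let ?Q = "PiM {n} (\<lambda>_. borel) :: (nat \<Rightarrow> real) measure"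
  let ?X = "\<lambda>\<omega>. \<lambda>i\<in>{..<n}. u i \<omega>" and ?Y = "\<lambda>\<omega>. \<lambda>i\<in>{n}. u i \<omega>"
  have "indep_var ?P ?X ?Q ?Y"
    by (rule indep_var_restrict[OF indep]) auto
  then have eq: "distr M ?P ?X \<Otimes>\<^sub>M distr M ?Q ?Y = distr M (?P \<Otimes>\<^sub>M ?Q) (\<lambda>\<omega>. (?X \<omega>, ?Y \<omega>))"
    and mX [measurable]: "?X \<in> M \<rightarrow>\<^sub>M ?P" and mY [measurable]: "?Y \<in> M \<rightarrow>\<^sub>M ?Q"
    by (simp_all only: indep_var_distribution_eq)
  have mu [measurable]: "u n \<in> M \<rightarrow>\<^sub>M borel"
    using indep by (auto simp: indep_vars_def)
  interpret Y: prob_space "distr M ?Q ?Y" by (rule prob_space_distr) (rule mY)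
  \<comment> \<open>Independence of blocks presents the current sample as a family over the
    singleton \<open>{n}\<close>; \<open>H'\<close> reads off its only coordinate.\<close>
  define H' where "H' = (\<lambda>(p, q). H (p, q n))"
  have H' [measurable]: "H' \<in> borel_measurable (?P \<Otimes>\<^sub>M ?Q)"
  proof -
    have "(\<lambda>z. (fst z, snd z n)) \<in> ?P \<Otimes>\<^sub>M ?Q \<rightarrow>\<^sub>M ?P \<Otimes>\<^sub>M borel"
      by measurable
    from measurable_compose[OF this H] show ?thesis
      by (simp add: H'_def case_prod_beta')
  qed
  have H'' [measurable]: "H' \<in> borel_measurable (?P \<Otimes>\<^sub>M distr M ?Q ?Y)"
    using H' by (simp cong: measurable_cong_sets)
  have "(\<integral>\<^sup>+\<omega>. H (?X \<omega>, u n \<omega>) \<partial>M) = (\<integral>\<^sup>+\<omega>. H' (?X \<omega>, ?Y \<omega>) \<partial>M)"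
    by (simp add: H'_def)
  also have "\<dots> = (\<integral>\<^sup>+z. H' z \<partial>distr M (?P \<Otimes>\<^sub>M ?Q) (\<lambda>\<omega>. (?X \<omega>, ?Y \<omega>)))"
    by (subst nn_integral_distr) measurable
  also have "\<dots> = (\<integral>\<^sup>+p. (\<integral>\<^sup>+q. H' (p, q) \<partial>distr M ?Q ?Y) \<partial>distr M ?P ?X)"
    unfolding eq[symmetric] by (intro Y.nn_integral_fst[symmetric]) (simp cong: measurable_cong_sets)
  also have "\<dots> = (\<integral>\<^sup>+\<omega>. (\<integral>\<^sup>+q. H' (?X \<omega>, q) \<partial>distr M ?Q ?Y) \<partial>M)"
    using Y.borel_measurable_nn_integral_fst[OF H''] by (intro nn_integral_distr) auto
  also have "\<dots> = (\<integral>\<^sup>+\<omega>. (\<integral>\<^sup>+t. H (?X \<omega>, t) \<partial>distr M borel (u n)) \<partial>M)"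
  proof (rule nn_integral_cong)
    fix \<omega> assume "\<omega> \<in> space M"
    then have sp: "?X \<omega> \<in> space ?P" by (rule measurable_space[OF mX])
    have "(\<lambda>t. H (?X \<omega>, t)) \<in> borel_measurable borel"
      by (rule measurable_compose[OF measurable_Pair1'[OF sp] H])
    moreover have "(\<lambda>q. H' (?X \<omega>, q)) \<in> borel_measurable ?Q"
      by (rule measurable_compose[OF measurable_Pair1'[OF sp] H'])
    ultimately show "(\<integral>\<^sup>+q. H' (?X \<omega>, q) \<partial>distr M ?Q ?Y)
        = (\<integral>\<^sup>+t. H (?X \<omega>, t) \<partial>distr M borel (u n))"
      by (subst (1 2) nn_integral_distr) (auto simp: H'_def)
  qed
  finally show ?thesis .
qed

text \<open>The induction tracks the mass lost when the path is stopped at its first exit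
  above \<open>c\<close>.\<close>

lemma markov_maximal_inequality:
  fixes u :: "nat \<Rightarrow> 'a \<Rightarrow> real" and V :: "nat \<Rightarrow> 's \<Rightarrow> real"
  assumes indep: "indep_vars (\<lambda>_. borel) u UNIV"
    and F: "\<And>k. (\<lambda>(s, t). F k s t) \<in> N \<Otimes>\<^sub>M borel \<rightarrow>\<^sub>M N" and s: "s \<in> space N"
    and V [measurable]: "\<And>k. V k \<in> borel_measurable N"
    and drift: "\<And>k s. s \<in> space N \<Longrightarrow>
      (\<integral>\<^sup>+t. ennreal (V (Suc k) (F k s t)) \<partial>distr M borel (u k)) \<le> ennreal (V k s)"
    and c: "c \<ge> 0"
  shows "ennreal c * emeasure M {\<omega>\<in>space M. \<exists>j<n. V j (markov_path F s (\<lambda>k. u k \<omega>) j) > c}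
    \<le> ennreal (V 0 s)"
proof -
  define S where "S \<omega> k = markov_path F s (\<lambda>k. u k \<omega>) k" for \<omega> k
  define E where "E n = {\<omega>\<in>space M. \<exists>j<n. V j (S \<omega> j) > c}" for n
  \<comment> \<open>The energy at index \<open>n\<close>, kept only on paths whose states before
    \<open>n\<close> have not exceeded \<open>c\<close>.\<close>
  define W where "W n \<omega> = ennreal (V n (S \<omega> n)) * indicator (- E n) \<omega>" for n \<omega>
  have mu [measurable]: "u k \<in> M \<rightarrow>\<^sub>M borel" for k
    using indep by (auto simp: indep_vars_def)
  have mR: "(\<lambda>\<omega>. \<lambda>i\<in>{..<n}. u i \<omega>) \<in> M \<rightarrow>\<^sub>M PiM {..<n} (\<lambda>_. borel)" for n
    by (intro measurable_restrict) simp
  have path: "S \<omega> k = markov_path F s (\<lambda>i\<in>{..<n}. u i \<omega>) k" if "k \<le> n" for \<omega> k n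
    unfolding S_def using that by (intro markov_path_cong) auto
  have mS [measurable]: "(\<lambda>\<omega>. S \<omega> k) \<in> M \<rightarrow>\<^sub>M N" for k
    unfolding path[OF order_refl]
    by (rule measurable_compose[OF mR measurable_markov_path[OF F s order_refl]])
  have mE [measurable]: "E n \<in> sets M" for n
    unfolding E_def by measurable
  have step: "(\<integral>\<^sup>+\<omega>. W (Suc n) \<omega> \<partial>M)
      \<le> (\<integral>\<^sup>+\<omega>. ennreal (V n (S \<omega> n)) * indicator (- E (Suc n)) \<omega> \<partial>M)" for n
  proof -
    let ?P = "PiM {..<n} (\<lambda>_. borel) :: (nat \<Rightarrow> real) measure"
    \<comment> \<open>\<open>E (Suc n)\<close> concerns the states up to index \<open>n\<close>,
      hence only samples before \<open>u n\<close>. \<open>B\<close> is this event in the space of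
      past samples, so its indicator is constant while \<open>u n\<close> is integrated out.\<close>
    define B where "B = {p\<in>space ?P. \<exists>j\<le>n. V j (markov_path F s p j) > c}"
    have mm: "(\<lambda>p. markov_path F s p j) \<in> ?P \<rightarrow>\<^sub>M N" if "j \<le> n" for j
      by (rule measurable_markov_path[OF F s that])
    have [measurable]: "B \<in> sets ?P"
    proof -
      have "B = (\<Union>j\<le>n. {p\<in>space ?P. V j (markov_path F s p j) > c})"
        by (auto simp: B_def)
      moreover have "{p\<in>space ?P. V j (markov_path F s p j) > c} \<in> sets ?P" if "j \<le> n" for j
      proof -
        have [measurable]: "(\<lambda>p. V j (markov_path F s p j)) \<in> borel_measurable ?P"
          using that by (intro measurable_compose[OF mm V])
        show ?thesis by measurable
      qed
      ultimately show ?thesis by auto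
    qed
    define H where "H = (\<lambda>(p, t). ennreal (V (Suc n) (F n (markov_path F s p n) t))
      * indicator (- B) p)"
    have "(\<lambda>(p, t). F n (markov_path F s p n) t) \<in> ?P \<Otimes>\<^sub>M borel \<rightarrow>\<^sub>M N"
    proof -
      have "(\<lambda>z. (markov_path F s (fst z) n, snd z)) \<in> ?P \<Otimes>\<^sub>M borel \<rightarrow>\<^sub>M N \<Otimes>\<^sub>M (borel :: real measure)"
        using mm[OF order_refl] by measurable
      from measurable_compose[OF this F[of n]] show ?thesis by (simp add: case_prod_beta)
    qed
    from measurable_compose[OF this V[of "Suc n"]]
    have mH: "H \<in> borel_measurable (?P \<Otimes>\<^sub>M borel)"
      unfolding H_def case_prod_beta by measurable
    have ind: "indicator (- E (Suc n)) \<omega> = (indicator (- B) (\<lambda>i\<in>{..<n}. u i \<omega>) :: ennreal)"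
      if "\<omega> \<in> space M" for \<omega>
    proof -
      have "\<omega> \<in> E (Suc n) \<longleftrightarrow> (\<lambda>i\<in>{..<n}. u i \<omega>) \<in> B"
        using that measurable_space[OF mR[of n] that] path[of _ n \<omega>]
        by (auto simp: E_def B_def less_Suc_eq_le)
      then show ?thesis by (simp add: indicator_def)
    qed
    have "(\<integral>\<^sup>+\<omega>. W (Suc n) \<omega> \<partial>M)
        = (\<integral>\<^sup>+\<omega>. H (\<lambda>i\<in>{..<n}. u i \<omega>, u n \<omega>) \<partial>M)"
      by (intro nn_integral_cong) (simp add: W_def H_def ind path[of n n, symmetric] S_def)
    also have "\<dots> = (\<integral>\<^sup>+\<omega>. (\<integral>\<^sup>+t. H (\<lambda>i\<in>{..<n}. u i \<omega>, t) \<partial>distr M borel (u n)) \<partial>M)"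
      by (rule nn_integral_past_present[OF indep mH])
    also have "\<dots> \<le> (\<integral>\<^sup>+\<omega>. ennreal (V n (S \<omega> n)) * indicator (- E (Suc n)) \<omega> \<partial>M)"
    proof (rule nn_integral_mono)
      fix \<omega> assume \<omega>: "\<omega> \<in> space M"
      have sp: "S \<omega> n \<in> space N" by (rule measurable_space[OF mS \<omega>])
      have "(\<lambda>t. F n (S \<omega> n) t) \<in> borel \<rightarrow>\<^sub>M N"
        using measurable_compose[OF measurable_Pair1'[OF sp] F[of n]] by simp
      then have "(\<lambda>t. ennreal (V (Suc n) (F n (S \<omega> n) t))) \<in> borel_measurable borel"
        by measurable
      then have "(\<integral>\<^sup>+t. H (\<lambda>i\<in>{..<n}. u i \<omega>, t) \<partial>distr M borel (u n))
          = (\<integral>\<^sup>+t. ennreal (V (Suc n) (F n (S \<omega> n) t)) \<partial>distr M borel (u n)) * indicator (- E (Suc n)) \<omega>"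
        unfolding H_def by (simp add: path[OF order_refl, symmetric] ind[OF \<omega>] nn_integral_multc)
      also have "\<dots> \<le> ennreal (V n (S \<omega> n)) * indicator (- E (Suc n)) \<omega>"
        using drift[OF sp, of n] by (intro mult_right_mono) auto
      finally show "(\<integral>\<^sup>+t. H (\<lambda>i\<in>{..<n}. u i \<omega>, t) \<partial>distr M borel (u n)) \<le> ennreal (V n (S \<omega> n)) * indicator (- E (Suc n)) \<omega>" .
    qed
    finally show ?thesis .
  qed
  have "(\<integral>\<^sup>+\<omega>. W n \<omega> \<partial>M) + ennreal c * emeasure M (E n) \<le> ennreal (V 0 s)"
  proof (induction n)
    case 0
    have "E 0 = {}" by (simp add: E_def)
    then show ?case by (simp add: W_def S_def emeasure_space_1)
  next
    case (Suc n)
    have "(\<integral>\<^sup>+\<omega>. W (Suc n) \<omega> \<partial>M) + ennreal c * emeasure M (E (Suc n))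
        \<le> (\<integral>\<^sup>+\<omega>. ennreal (V n (S \<omega> n)) * indicator (- E (Suc n)) \<omega> \<partial>M)
          + ennreal c * emeasure M (E (Suc n))"
      by (intro add_right_mono step)
    also have "\<dots> = (\<integral>\<^sup>+\<omega>. ennreal (V n (S \<omega> n)) * indicator (- E (Suc n)) \<omega>
        + ennreal c * indicator (E (Suc n)) \<omega> \<partial>M)"
      by (subst nn_integral_add) (auto simp: nn_integral_cmult_indicator)
    also have "\<dots> \<le> (\<integral>\<^sup>+\<omega>. W n \<omega> + ennreal c * indicator (E n) \<omega> \<partial>M)"
    proof (rule nn_integral_mono)
      fix \<omega> assume \<omega>: "\<omega> \<in> space M"
      \<comment> \<open>A path that first exceeds \<open>c\<close> at index \<open>n\<close> gives
        up the energy \<open>V n\<close>, which covers the added \<open>c\<close>.\<close>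
      have "\<omega> \<in> E (Suc n) \<longleftrightarrow> \<omega> \<in> E n \<or> V n (S \<omega> n) > c"
        using \<omega> by (auto simp: E_def less_Suc_eq)
      then show "ennreal (V n (S \<omega> n)) * indicator (- E (Suc n)) \<omega> + ennreal c * indicator (E (Suc n)) \<omega>
          \<le> W n \<omega> + ennreal c * indicator (E n) \<omega>"
        by (cases "\<omega> \<in> E n"; cases "V n (S \<omega> n) > c") (auto simp: W_def intro: ennreal_leI)
    qed
    also have "\<dots> = (\<integral>\<^sup>+\<omega>. W n \<omega> \<partial>M) + ennreal c * emeasure M (E n)"
      unfolding W_def by (subst nn_integral_add) (auto simp: nn_integral_cmult_indicator)
    also note Suc.IH
    finally show ?case .
  qed
  then have "ennreal c * emeasure M (E n) \<le> ennreal (V 0 s)"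
    by (rule order_trans[rotated]) (simp add: add_increasing)
  then show ?thesis unfolding E_def S_def .
qed

text \<open>The maximal inequality, passed to infinite time, bounds the probability of ever
  exceeding \<open>c\<close> by a constant over \<open>c\<close>; hence exceeding every integer
  level is a null event.\<close>

lemma markov_drift_bounded:
  fixes u :: "nat \<Rightarrow> 'a \<Rightarrow> real" and V :: "nat \<Rightarrow> 's \<Rightarrow> real"
  assumes indep: "indep_vars (\<lambda>_. borel) u UNIV"
    and F: "\<And>k. (\<lambda>(s, t). F k s t) \<in> N \<Otimes>\<^sub>M borel \<rightarrow>\<^sub>M N" and s: "s \<in> space N"
    and V [measurable]: "\<And>k. V k \<in> borel_measurable N"
    and drift: "\<And>k s. s \<in> space N \<Longrightarrow>
      (\<integral>\<^sup>+t. ennreal (V (Suc k) (F k s t)) \<partial>distr M borel (u k)) \<le> ennreal (V k s)"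
  shows "AE \<omega> in M. \<exists>C. \<forall>j. V j (markov_path F s (\<lambda>k. u k \<omega>) j) \<le> C"
proof -
  define S where "S \<omega> k = markov_path F s (\<lambda>k. u k \<omega>) k" for \<omega> k
  define X where "X c n = {\<omega>\<in>space M. \<exists>j<n. V j (S \<omega> j) > c}" for c :: real and n
  have mu [measurable]: "u k \<in> M \<rightarrow>\<^sub>M borel" for k
    using indep by (auto simp: indep_vars_def)
  have mS [measurable]: "(\<lambda>\<omega>. S \<omega> k) \<in> M \<rightarrow>\<^sub>M N" for k
  proof (induction k)
    case 0
    then show ?case using s by (simp add: S_def)
  next
    case (Suc k)
    have "(\<lambda>\<omega>. (S \<omega> k, u k \<omega>)) \<in> M \<rightarrow>\<^sub>M N \<Otimes>\<^sub>M borel"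
      using Suc by measurable
    from measurable_compose[OF this F[of k]] show ?case by (simp add: S_def)
  qed
  have [measurable]: "X c n \<in> sets M" for c n
    unfolding X_def by measurable
  define Z where "Z c = (\<Union>n. X c n)" for c
  have [measurable]: "Z c \<in> sets M" for c
    unfolding Z_def by measurable
  have Z: "ennreal c * emeasure M (Z c) \<le> ennreal (V 0 s)" if "c \<ge> 0" for c
  proof -
    have "incseq (X c)"
      by (auto simp: incseq_def X_def intro: less_le_trans)
    then have "emeasure M (Z c) = (SUP n. emeasure M (X c n))"
      unfolding Z_def by (intro SUP_emeasure_incseq[symmetric]) auto
    then have "ennreal c * emeasure M (Z c) = (SUP n. ennreal c * emeasure M (X c n))"
      by (simp add: SUP_mult_left_ennreal)
    also have "\<dots> \<le> ennreal (V 0 s)"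
      unfolding X_def S_def
      by (intro SUP_least markov_maximal_inequality[OF indep F s V drift that])
    finally show ?thesis .
  qed
  have "emeasure M (\<Inter>m. Z (real m)) = 0"
  proof (rule ccontr)
    assume *: "emeasure M (\<Inter>m. Z (real m)) \<noteq> 0"
    define e where "e = measure M (\<Inter>m. Z (real m))"
    have e: "e > 0"
      using * by (simp add: e_def emeasure_eq_measure zero_less_measure_iff)
    \<comment> \<open>The \<open>max 0\<close> is there because \<open>V\<close> may be negative and
      \<open>ennreal\<close> sends negative reals to 0.\<close>
    have "real m * e \<le> max 0 (V 0 s)" for m
    proof -
      have "ennreal (real m) * ennreal e \<le> ennreal (real m) * emeasure M (Z (real m))"
        unfolding e_def emeasure_eq_measure[symmetric]
        by (intro mult_left_mono emeasure_mono) auto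
      also have "\<dots> \<le> ennreal (max 0 (V 0 s))"
        using Z[of "real m"] by (cases "V 0 s \<ge> 0") (auto simp: max_def ennreal_neg)
      finally have "ennreal (real m * e) \<le> ennreal (max 0 (V 0 s))"
        using e by (simp only: ennreal_mult''[symmetric] less_imp_le)
      then show ?thesis
        by (rule ennreal_le_iff[THEN iffD1, rotated]) simp
    qed
    moreover obtain m where "real m > max 0 (V 0 s) / e"
      using reals_Archimedean2 by blast
    ultimately show False
      using e by (auto simp: field_simps not_less[symmetric])
  qed
  then have "AE \<omega> in M. \<omega> \<notin> (\<Inter>m. Z (real m))"
    by (intro AE_not_in) (auto simp: null_sets_def)
  then show ?thesis
    using AE_space
  proof eventually_elim
    case (elim \<omega>)
    then obtain m where "\<omega> \<notin> Z (real m)" by auto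
    have "V j (S \<omega> j) \<le> real m" for j
    proof (rule ccontr)
      assume "\<not> V j (S \<omega> j) \<le> real m"
      with elim(2) have "\<omega> \<in> X (real m) (Suc j)"
        unfolding X_def by (auto simp: not_le)
      with \<open>\<omega> \<notin> Z (real m)\<close> show False
        unfolding Z_def by blast
    qed
    then show ?case unfolding S_def by blast
  qed
qed

end

subsection \<open>The heavy-ball trajectory\<close>

lemma A_seq_ge_1: "1 \<le> A_seq k"
  by (simp add: A_seq_def ge_one_powr_ge_zero)

lemma A_seq_less: "A_seq k < A_seq (Suc k)"
  unfolding A_seq_def by (intro powr_less_mono2) auto

text \<open>By the mean value theorem an increment is at most
  \<open>1 / 12 * (4 / 3) = 1 / 9\<close> times the cube root of \<open>r'\<close>, and the square
  of that root is \<open>r' powr (2 / 3)\<close>, the square root of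
  \<open>A_seq (Suc k)\<close>.\<close>

lemma A_seq_diff_sq_le: "(A_seq (Suc k) - A_seq k)\<^sup>2 \<le> sqrt (A_seq (Suc k)) / 81"
proof -
  define r where "r = 1 + real k / 12"
  define r' where "r' = 1 + real (Suc k) / 12"
  have r: "r \<ge> 1" and rr': "r < r'" "r' - r = 1 / 12" by (simp_all add: r_def r'_def field_simps)
  have "((\<lambda>x. x powr (4 / 3)) has_real_derivative 4 / 3 * x powr (1 / 3)) (at x)" if "r \<le> x" for x
    using that r by (auto intro!: derivative_eq_intros)
  from MVT2[OF rr'(1) this] obtain \<xi> where \<xi>: "r < \<xi>" "\<xi> < r'"
    and eq: "r' powr (4 / 3) - r powr (4 / 3) = (r' - r) * (4 / 3 * \<xi> powr (1 / 3))"
    by blast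
  have "\<xi> powr (1 / 3) \<le> r' powr (1 / 3)"
    using r \<xi> by (intro powr_mono2) auto
  then have "A_seq (Suc k) - A_seq k \<le> r' powr (1 / 3) / 9"
    using eq unfolding rr' A_seq_def r_def[symmetric] r'_def[symmetric] by simp
  then have "(A_seq (Suc k) - A_seq k)\<^sup>2 \<le> (r' powr (1 / 3) / 9)\<^sup>2"
    using A_seq_less[of k] by (intro power_mono) auto
  also have "\<dots> = r' powr (2 / 3) / 81"
    using powr_add[of r' "1 / 3" "1 / 3"] by (simp add: power2_eq_square)
  also have "r' powr (2 / 3) = sqrt (A_seq (Suc k))"
    using r rr' unfolding A_seq_def r'_def[symmetric]
    by (simp add: powr_half_sqrt[symmetric] powr_powr)
  finally show ?thesis .
qed

text \<open>A cruder bound by the left end point, for comparing positions inside one interval.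
  Increments up to 1 are covered by \<open>A_seq k \<ge> 1\<close>; for larger ones
  \<open>a \<le> a\<^sup>2\<close> is absorbed on the left.\<close>

lemma A_seq_diff_sq_le_self: "(A_seq (Suc k) - A_seq k)\<^sup>2 \<le> A_seq k"
proof -
  define a where "a = A_seq (Suc k) - A_seq k"
  have "sqrt (A_seq (Suc k)) \<le> A_seq (Suc k)"
    using A_seq_ge_1[of "Suc k"] by (intro real_le_lsqrt) (auto simp: power2_eq_square)
  then have *: "81 * a\<^sup>2 \<le> A_seq k + a"
    using A_seq_diff_sq_le[of k] by (simp add: a_def)
  have "a\<^sup>2 \<le> A_seq k"
  proof (cases "a \<le> 1")
    case True
    then have "a\<^sup>2 \<le> 1"
      using A_seq_less[of k] by (intro power_le_one) (auto simp: a_def)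
    then show ?thesis using A_seq_ge_1[of k] by linarith
  next
    case False
    then have "a \<le> a\<^sup>2" by (simp add: power2_eq_square)
    then show ?thesis using * A_seq_ge_1[of k] by linarith
  qed
  then show ?thesis by (simp add: a_def)
qed

lemma powr_le_A_seq: "real k powr (4 / 3) \<le> 12 powr (4 / 3) * A_seq k"
proof -
  have "real k powr (4 / 3) \<le> (12 * (1 + real k / 12)) powr (4 / 3)"
    by (intro powr_mono2) (auto simp: field_simps)
  also have "\<dots> = 12 powr (4 / 3) * A_seq k"
    unfolding A_seq_def by (subst powr_mult) auto
  finally show ?thesis .
qed

lemma delta_pos:
  assumes "0 < p k" "p k < p (Suc k)"
  shows "0 < delta p k"
proof -
  have "(p k)\<^sup>2 < (p (Suc k))\<^sup>2" using assms by (intro power_strict_mono) auto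
  then show ?thesis using assms by (simp add: delta_def frac_less2)
qed

section \<open>Heavy-ball iterates as positions at the sampled times\<close>

context smooth_convex
begin

abbreviation state :: "'a \<Rightarrow> (nat \<Rightarrow> real) \<Rightarrow> nat \<Rightarrow> 'a \<times> 'a" where
  "state x0 p k \<equiv> markov_path (\<lambda>k. advance (A_seq k) (A_seq (Suc k))) (x0, x0) p k"

text \<open>The iterate is the ballistic point just before its kick. Since \<open>z\<close> is
  constant between kicks, eliminating it from two consecutive positions leaves a two-term recursion
  with exactly the coefficients \<open>eta\<close> and \<open>beta\<close>.\<close>

lemma heavy_ball_eq_position:
  assumes p: "\<And>k. 0 < p k" "\<And>k. p k < p (Suc k)"
  shows "heavy_ball g (eta L p) (beta p) x0 k = position (A_seq k) (state x0 p k) (p k)"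
proof -
  define X where "X k = position (A_seq k) (state x0 p k) (p k)" for k
  define Z where "Z k = snd (state x0 p k)" for k
  define r where "r k = (p k)\<^sup>2 / (p (Suc k))\<^sup>2" for k
  have A: "A_seq k > 0" for k using A_seq_ge_1[of k] by linarith
  have p0: "p k \<noteq> 0" for k using p(1)[of k] by simp
  have \<delta>: "delta p k \<noteq> 0" for k using delta_pos[of p k] p by auto
  \<comment> \<open>\<open>r k\<close> is the contraction factor from \<open>p k\<close> to
    \<open>p (Suc k)\<close>, the grid point between them having cancelled. This identity explains
    the formula for \<open>delta\<close>.\<close>
  have r: "1 - r k = 2 * (p k)\<^sup>2 * delta p k" for k
    using p0[of k] p0[of "Suc k"] by (simp add: r_def delta_def field_simps)
  have Z: "Z (Suc k) = Z k - ((A_seq (Suc k) - A_seq k) / (2 * L)) *\<^sub>R g (X k)" for k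
    by (simp add: Z_def X_def advance_def kick_def)
  have X: "X (Suc k) = Z (Suc k) + r k *\<^sub>R (X k - Z (Suc k))" for k
    using A[of "Suc k"] p0[of "Suc k"]
    by (simp add: X_def Z_def position_def[of "A_seq (Suc k)"] advance_def r_def)
  have 1: "X (Suc k) = X k - eta L p k *\<^sub>R g (X k) + (1 - r k) *\<^sub>R (Z k - X k)" for k
  proof -
    define b where "b = (A_seq (Suc k) - A_seq k) / (2 * L)"
    have eta: "eta L p k = (1 - r k) * b"
      unfolding r eta_def b_def by simp
    show ?thesis unfolding X Z b_def[symmetric] eta by (simp add: algebra_simps)
  qed
  \<comment> \<open>For \<open>k = 0\<close> both sides vanish, since \<open>z\<close> starts at
    \<open>x0\<close> and \<open>beta p 0 = 0\<close>. Otherwise \<open>Z k - X k\<close> and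
    \<open>X k - X (k - 1)\<close> are both multiples of \<open>Z k - X (k - 1)\<close>.\<close>
  have 2: "(1 - r k) *\<^sub>R (Z k - X k) = beta p k *\<^sub>R (X k - X (k - 1))" for k
  proof (cases k)
    case 0
    then show ?thesis by (simp add: beta_def X_def Z_def position_def)
  next
    case (Suc j)
    have "(1 - r k) * r j = beta p k * (1 - r j)"
      unfolding r beta_def using \<delta>[of j] p0[of j] p0[of k]
      by (simp add: Suc r_def)
    moreover have "Z k - X k = r j *\<^sub>R (Z k - X j)" "X k - X j = (1 - r j) *\<^sub>R (Z k - X j)"
      unfolding Suc X by (simp_all add: algebra_simps)
    ultimately show ?thesis by (simp add: Suc)
  qed
  \<comment> \<open>All \<open>j \<le> k\<close> are treated together because the recursion looks
    two iterates back.\<close>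
  have "heavy_ball g (eta L p) (beta p) x0 j = X j" if "j \<le> k" for j
    using that
  proof (induction k arbitrary: j)
    case 0
    then show ?case by (simp add: X_def position_def)
  next
    case (Suc k)
    then show ?case
      using 1[of k] 2[of k] by (cases "j = Suc k") auto
  qed
  then show ?thesis by (simp add: X_def)
qed

text \<open>The energy controls \<open>f\<close> at time \<open>A\<close>, the iterate sits at a
  later \<open>t\<close>. Descent and Young's inequality give twice the gap at \<open>y\<close> plus
  \<open>L * (norm (x - y))\<^sup>2\<close>; the displacement is \<open>c *\<^sub>R w\<close> with
  \<open>A * c \<le> 2 * (B - A)\<close>, hence \<open>A * c\<^sup>2 \<le> 4\<close>.\<close>

lemma position_gap_le_energy:
  assumes A: "0 < A" and t: "A \<le> t" "t \<le> B" and a: "(B - A)\<^sup>2 \<le> A"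
  shows "A * (f (position A s t) - f xs) \<le> 4 * energy A s"
proof -
  define y w x where "y = fst s" and "w = snd s - fst s" and "x = position A s t"
  define c where "c = 1 - A\<^sup>2 / t\<^sup>2"
  have x: "x - y = c *\<^sub>R w"
    by (simp add: x_def y_def w_def c_def position_def algebra_simps)
  have c0: "0 \<le> c" using A t by (simp add: c_def)
  have "A * c \<le> 2 * (B - A)"
  proof -
    have "A * c = A * (t + A) / t\<^sup>2 * (t - A)"
      using A t by (simp add: c_def field_simps power2_eq_square)
    also have "\<dots> \<le> 2 * (t - A)"
    proof (rule mult_right_mono)
      have "A * (t + A) \<le> t * (t + t)" using A t by (intro mult_mono) auto
      then show "A * (t + A) / t\<^sup>2 \<le> 2" using A t by (simp add: field_simps power2_eq_square)
    qed (use t in simp)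
    also have "\<dots> \<le> 2 * (B - A)" using t by simp
    finally show ?thesis .
  qed
  then have "(A * c)\<^sup>2 \<le> (2 * (B - A))\<^sup>2" using A c0 by (intro power_mono) auto
  then have "A * (A * c\<^sup>2) \<le> A * 4" using a by (simp add: power2_eq_square algebra_simps)
  then have c: "A * c\<^sup>2 \<le> 4" using A by simp
  have "inner (x - y) (g y) \<le> norm (x - y) * norm (g y)" by (rule norm_cauchy_schwarz)
  also have "\<dots> \<le> L / 2 * (norm (x - y))\<^sup>2 + (norm (g y))\<^sup>2 / (2 * L)"
    using sum_squares_bound[of "L * norm (x - y)" "norm (g y)"] L_pos
    by (simp add: field_simps power2_eq_square)
  also have "(norm (g y))\<^sup>2 / (2 * L) \<le> f y - f xs"
    using norm_gradient_le_gap[of y] L_pos by (simp add: field_simps)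
  finally have "f x - f xs \<le> 2 * (f y - f xs) + L * (norm (x - y))\<^sup>2"
    using descent[of x y] by simp
  also have "L * (norm (x - y))\<^sup>2 = c\<^sup>2 * (L * (norm w)\<^sup>2)"
    by (simp add: x power_mult_distrib)
  finally have "A * (f x - f xs) \<le> A * (2 * (f y - f xs) + c\<^sup>2 * (L * (norm w)\<^sup>2))"
    using A by (intro mult_left_mono) auto
  also have "\<dots> = 2 * (A * (f y - f xs)) + A * c\<^sup>2 * (L * (norm w)\<^sup>2)"
    by (simp add: algebra_simps)
  also have "\<dots> \<le> 2 * (A * (f y - f xs)) + 4 * (L * (norm w)\<^sup>2)"
    using c L_pos by (intro add_left_mono mult_right_mono) auto
  also have "\<dots> \<le> 4 * energy A s"
    using mult_nonneg_nonneg[of A "f y - f xs"] minimizer[of y] A L_pos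
    by (simp add: energy_def y_def w_def)
  finally show ?thesis by (simp add: x_def)
qed

lemma heavy_ball_gap_le:
  assumes p: "\<And>k. p k \<in> {A_seq k<..<A_seq (Suc k)}"
    and C: "\<And>k. energy (A_seq k) (state x0 p k) \<le> C"
  shows "real k powr (4 / 3) * (f (heavy_ball g (eta L p) (beta p) x0 k) - f xs)
    \<le> 12 powr (4 / 3) * (4 * C)"
proof -
  let ?x = "heavy_ball g (eta L p) (beta p) x0 k"
  have pos: "0 < p k" and inc: "p k < p (Suc k)" for k
    using p[of k] p[of "Suc k"] A_seq_ge_1[of k] by auto
  have "?x = position (A_seq k) (state x0 p k) (p k)"
    by (rule heavy_ball_eq_position[where p = p, OF pos inc])
  then have "A_seq k * (f ?x - f xs) \<le> 4 * energy (A_seq k) (state x0 p k)"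
    using position_gap_le_energy[of "A_seq k" "p k" "A_seq (Suc k)"] p[of k]
      A_seq_ge_1[of k] A_seq_diff_sq_le_self[of k] by simp
  with C[of k] have *: "A_seq k * (f ?x - f xs) \<le> 4 * C" by linarith
  have "real k powr (4 / 3) * (f ?x - f xs) \<le> 12 powr (4 / 3) * A_seq k * (f ?x - f xs)"
    using minimizer[of ?x] by (intro mult_right_mono powr_le_A_seq) auto
  also have "\<dots> \<le> 12 powr (4 / 3) * (4 * C)"
    using mult_left_mono[OF *, of "12 powr (4 / 3)"] by (simp add: mult.assoc)
  finally show ?thesis .
qed

text \<open>Makes the bounded-supremum event measurable, so that its probability can be computed
  from an almost-everywhere statement.\<close>

lemma measurable_heavy_ball:
  assumes [measurable]: "\<And>k. u k \<in> borel_measurable M"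
  shows "(\<lambda>\<omega>. heavy_ball g (eta L (\<lambda>k. u k \<omega>)) (beta (\<lambda>k. u k \<omega>)) x0 k) \<in> borel_measurable M"
proof -
  have [measurable]: "(\<lambda>\<omega>. eta L (\<lambda>k. u k \<omega>) k) \<in> borel_measurable M"
    "(\<lambda>\<omega>. beta (\<lambda>k. u k \<omega>) k) \<in> borel_measurable M" for k
    unfolding eta_def beta_def delta_def by measurable
  have "(\<lambda>\<omega>. heavy_ball g (eta L (\<lambda>k. u k \<omega>)) (beta (\<lambda>k. u k \<omega>)) x0 j) \<in> borel_measurable M"
    if "j \<le> k" for j
    using that
  proof (induction k arbitrary: j)
    case 0
    then show ?case by simp
  next
    case (Suc k)
    show ?case
    proof (cases "j = Suc k")
      case True
      have [measurable]:
        "(\<lambda>\<omega>. heavy_ball g (eta L (\<lambda>k. u k \<omega>)) (beta (\<lambda>k. u k \<omega>)) x0 k) \<in> borel_measurable M"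
        "(\<lambda>\<omega>. heavy_ball g (eta L (\<lambda>k. u k \<omega>)) (beta (\<lambda>k. u k \<omega>)) x0 (k - 1)) \<in> borel_measurable M"
        using Suc.IH by auto
      show ?thesis unfolding True heavy_ball.simps by measurable
    qed (use Suc in auto)
  qed
  then show ?thesis by simp
qed

end

section \<open>Almost sure rate along one trajectory\<close>

theorem corollary12:
  fixes L :: real
    and f :: "real ^ 'd \<Rightarrow> real"
    and xstar x0 :: "real ^ 'd"
    and M :: "'w measure"
    and u :: "nat \<Rightarrow> 'w \<Rightarrow> real"
    and x :: "'w \<Rightarrow> nat \<Rightarrow> real ^ 'd"
  defines "x \<equiv> \<lambda>\<omega>. heavy_ball (gradient f) (eta L (\<lambda>k. u k \<omega>)) (beta (\<lambda>k. u k \<omega>)) x0"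
  assumes "L > 0"
    and "convex_on UNIV f"
    and "L_smooth L f"
    and "\<forall>y. f xstar \<le> f y"
    and "prob_space M"
    and "prob_space.indep_vars M (\<lambda>_. borel) u UNIV"
    and "\<forall>k. distr M borel (u k) = uniform_measure lborel {A_seq k<..<A_seq (k + 1)}"
  shows "(AE \<omega> in M. \<forall>k. delta (\<lambda>k. u k \<omega>) k > 0)
    \<and> \<P>(\<omega> in M. (SUP K\<in>{1..}. ereal (real K powr (4 / 3) * (f (x \<omega> K) - f xstar))) < \<infinity>) = 1
    \<and> (AE \<omega> in M. (\<lambda>K. f (x \<omega> K) - f xstar) \<in> O(\<lambda>K. real K powr (- 4 / 3)))"
proof -
  interpret smooth_convex f L xstar
    using assms(2-5) by unfold_locales auto
  interpret prob_space M by fact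
  note indep = \<open>prob_space.indep_vars M (\<lambda>_. borel) u UNIV\<close>
  have distr: "distr M borel (u k) = uniform_measure lborel {A_seq k<..<A_seq (Suc k)}" for k
    using assms(8) by simp
  have mu [measurable]: "u k \<in> borel_measurable M" for k
    using indep by (auto simp: indep_vars_def)
  have mx [measurable]: "(\<lambda>\<omega>. x \<omega> K) \<in> borel_measurable M" for K
    unfolding x_def by (rule measurable_heavy_ball[OF mu])
  have "AE \<omega> in M. u k \<omega> \<in> {A_seq k<..<A_seq (Suc k)}" for k
  proof -
    have "AE t in distr M borel (u k). t \<in> {A_seq k<..<A_seq (Suc k)}"
      unfolding distr by (rule AE_uniform_measureI) auto
    then show ?thesis by (rule AE_distrD[OF mu])
  qed
  then have range: "AE \<omega> in M. \<forall>k. u k \<omega> \<in> {A_seq k<..<A_seq (Suc k)}"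
    unfolding AE_all_countable by blast
  have pos: "AE \<omega> in M. \<forall>k. delta (\<lambda>k. u k \<omega>) k > 0"
    using range
  proof eventually_elim
    case (elim \<omega>)
    show ?case
    proof
      fix k
      show "delta (\<lambda>k. u k \<omega>) k > 0"
        using elim[rule_format, of k] elim[rule_format, of "Suc k"] A_seq_ge_1[of k]
        by (intro delta_pos) auto
    qed
  qed
  have "AE \<omega> in M. \<exists>C. \<forall>k. energy (A_seq k) (state x0 (\<lambda>k. u k \<omega>) k) \<le> C"
  proof (rule markov_drift_bounded[where N = borel, OF indep])
    fix k s
    show "(\<integral>\<^sup>+t. ennreal (energy (A_seq (Suc k)) (advance (A_seq k) (A_seq (Suc k)) s t))
        \<partial>distr M borel (u k)) \<le> ennreal (energy (A_seq k) s)"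
      unfolding distr using A_seq_ge_1[of k] A_seq_ge_1[of "Suc k"]
      by (intro nn_integral_energy_advance_le A_seq_less A_seq_diff_sq_le) auto
  qed (auto intro: measurable_advance)
  with range have bounded: "AE \<omega> in M. \<exists>C. \<forall>K. real K powr (4 / 3) * (f (x \<omega> K) - f xstar) \<le> C"
  proof eventually_elim
    case (elim \<omega>)
    then obtain C where "\<And>k. energy (A_seq k) (state x0 (\<lambda>k. u k \<omega>) k) \<le> C" by blast
    then have "real K powr (4 / 3) * (f (x \<omega> K) - f xstar) \<le> 12 powr (4 / 3) * (4 * C)" for K
      unfolding x_def by (intro heavy_ball_gap_le elim(1)[rule_format])
    then show ?case by blast
  qed
  have "AE \<omega> in M. (SUP K\<in>{1..}. ereal (real K powr (4 / 3) * (f (x \<omega> K) - f xstar))) < \<infinity>"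
    using bounded
  proof eventually_elim
    case (elim \<omega>)
    then obtain C where "\<And>K. real K powr (4 / 3) * (f (x \<omega> K) - f xstar) \<le> C" by blast
    then have "(SUP K\<in>{1..}. ereal (real K powr (4 / 3) * (f (x \<omega> K) - f xstar))) \<le> ereal C"
      by (intro SUP_least) auto
    then show ?case by (rule le_less_trans) simp
  qed
  moreover have "{\<omega>\<in>space M. (SUP K\<in>{1..}. ereal (real K powr (4 / 3) * (f (x \<omega> K) - f xstar))) < \<infinity>}
      \<in> sets M"
    by measurable
  ultimately have prob:
    "\<P>(\<omega> in M. (SUP K\<in>{1..}. ereal (real K powr (4 / 3) * (f (x \<omega> K) - f xstar))) < \<infinity>) = 1"
    by (simp add: prob_Collect_eq_1)
  have "AE \<omega> in M. (\<lambda>K. f (x \<omega> K) - f xstar) \<in> O(\<lambda>K. real K powr (- 4 / 3))"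
    using bounded
  proof eventually_elim
    case (elim \<omega>)
    then obtain C where C: "\<And>K. real K powr (4 / 3) * (f (x \<omega> K) - f xstar) \<le> C" by blast
    show ?case
    \<comment> \<open>Index 0 is left out: \<open>0 powr _ = 0\<close>, so the two powers cancel
      only from 1 on.\<close>
    proof (rule bigoI[where c = C], rule eventually_sequentiallyI[of 1])
      fix K :: nat assume "1 \<le> K"
      then have "f (x \<omega> K) - f xstar
          = real K powr (4 / 3) * (f (x \<omega> K) - f xstar) * real K powr (- 4 / 3)"
        by (simp add: powr_minus)
      also have "\<dots> \<le> C * real K powr (- 4 / 3)"
        by (intro mult_right_mono C) simp
      finally show "norm (f (x \<omega> K) - f xstar) \<le> C * norm (real K powr (- 4 / 3))"
        using minimizer[of "x \<omega> K"] by simp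
    qed
  qed
  with pos prob show ?thesis by blast
qed

end
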